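(* There exists $k_0$ such that for all integers $k\ge k_0$ and all positive integers $m\le k/4$, setting $n=(k-1)(k+1-m)+m$ and $s=n-2k+2-m$, there exist $s$ non-trivial intersecting families $\mathcal F_1,\dots,\mathcal F_s\subset\binom{[n]}{k}$ such that $$\Big|\bigcup_{i=1}^s\mathcal F_i\Big|>\binom{n}{k}-\binom{n-s}{k}.$$
   Context: $[n]=\{1,\dots,n\}$ and $\binom{[n]}{k}$ is the set of $k$-element subsets of $[n]$. A family $\mathcal F$ is intersecting if $A\cap B\ne\emptyset$ for all $A,B\in\mathcal F$. The covering number $\tau(\mathcal F)$ is the smallest size of a set meeting every member of $\mathcal F$; an intersecting family is non-trivial if $\tau(\mathcal F)\ge2$, i.e. no single element lies in all its members. *)

theory Defs
  imports Complex_Main "HOL-Library.Ramsey"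
begin

definition intersecting :: "'a set set \<Rightarrow> bool" where
  "intersecting \<F> \<longleftrightarrow> (\<forall>A\<in>\<F>. \<forall>B\<in>\<F>. A \<inter> B \<noteq> {})"

(* Covers T are required to be finite since card is 0 on infinite sets. A family containing
   the empty set has no cover; this never happens for an intersecting family. *)
definition covering_number :: "'a set set \<Rightarrow> nat" where
  "covering_number \<F> =
     (LEAST t. \<exists>T. finite T \<and> card T = t \<and> (\<forall>A\<in>\<F>. A \<inter> T \<noteq> {}))"

definition nontrivial_intersecting :: "'a set set \<Rightarrow> bool" where
  "nontrivial_intersecting \<F> \<longleftrightarrow> intersecting \<F> \<and> covering_number \<F> \<ge> 2"

end

theory Submission
  imports Defs "HOL-Library.Disjoint_Sets"
begin

text \<open>
  Put \<open>v = k + 1 - m\<close> and split the ground set into \<open>k - 1\<close> blocks \<open>V\<^sub>j\<close> of size \<open>v\<close> and a remainder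
  \<open>M\<close> of size \<open>m\<close>. Each block gets \<open>v - 2\<close> families: after choosing three points \<open>T\<^sub>j\<close> of \<open>V\<^sub>j\<close>, the
  sets with at least two points in \<open>T\<^sub>j\<close>, and for every other \<open>y\<close> in \<open>V\<^sub>j\<close> the Hilton--Milner family
  with centre \<open>y\<close> and exceptional set \<open>(V\<^sub>j - {y}) \<union> M\<close>, which has exactly \<open>k\<close> elements.
  If an uncovered \<open>F\<close> contained such a centre \<open>y\<close>, it would miss \<open>M\<close> and meet every block at most
  once, which is impossible for a \<open>k\<close>-set and \<open>k - 1\<close> blocks. Hence \<open>F\<close> consists of points of \<open>M\<close>
  and at most one point of each \<open>T\<^sub>j\<close>, so the number of uncovered sets is at most
  \<open>(1 + x)\<^sup>m (1 + 3 x)\<^bsup>k - 1\<^esup> / x\<^sup>k\<close> for every \<open>x > 0\<close>. With \<open>x = 7/4\<close>, which is nearly optimal for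
  \<open>m = k/4\<close>, this is smaller than \<open>(2k - 2 + m) choose k = (n - s) choose k\<close> for large \<open>k\<close>: raising \<open>m\<close>
  by one multiplies the binomial by at most \<open>2 < 1 + x\<close>, so only \<open>m = \<lfloor>k/4\<rfloor>\<close> matters, where
  the growth per four steps of \<open>k\<close> is \<open>9\<^sup>9 / (4\<^sup>4 5\<^sup>5) > 484\<close> against \<open>(11/4) (25/7)\<^sup>4 < 448\<close>.
\<close>

section \<open>Two kinds of non-trivial intersecting families\<close>

text \<open>A cover must be exhibited before \<open>LEAST\<close> in \<open>covering_number\<close>
  says anything; \<open>U\<close> is one because the members are nonempty subsets of it.\<close>

lemma covering_number_ge_2I:
  assumes "finite U" and sub: "\<And>A. A \<in> \<F> \<Longrightarrow> A \<subseteq> U \<and> A \<noteq> {}"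
    and avoid: "\<And>t. \<exists>A\<in>\<F>. t \<notin> A"
  shows "covering_number \<F> \<ge> 2"
proof -
  let ?P = "\<lambda>t. \<exists>T. finite T \<and> card T = t \<and> (\<forall>A\<in>\<F>. A \<inter> T \<noteq> {})"
  have "\<forall>A\<in>\<F>. A \<inter> U \<noteq> {}"
    using sub by blast
  with \<open>finite U\<close> have "?P (card U)" by (intro exI[of _ U]) simp
  then have "?P (covering_number \<F>)"
    unfolding covering_number_def by (rule LeastI)
  then obtain T where T: "finite T" "card T = covering_number \<F>" "\<forall>A\<in>\<F>. A \<inter> T \<noteq> {}"
    by blast
  show ?thesis
  proof (rule ccontr)
    assume "\<not> 2 \<le> covering_number \<F>"
    with T have "card T = 0 \<or> card T = 1" by linarith
    \<comment> \<open>The empty cover is treated together with the singletons: a member avoiding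
      \<open>t\<close> misses \<open>T\<close> in both cases.\<close>
    then obtain t where "T \<subseteq> {t}"
      using T(1) by (auto simp: card_1_singleton_iff)
    with T(3) avoid[of t] show False by blast
  qed
qed

lemma nsets_extend_avoiding:
  assumes "finite X" "A \<subseteq> X" "card A \<le> k" "k < card X" "t \<notin> A"
  obtains F where "F \<in> nsets X k" "A \<subseteq> F" "t \<notin> F"
proof -
  have "k \<le> card (X - {t})"
    using assms by (auto simp: card_Diff_singleton_if)
  then obtain F where "A \<subseteq> F" "F \<subseteq> X - {t}" "card F = k"
    using exists_subset_between[of A k "X - {t}"] assms by auto
  with assms(1) show thesis
    by (intro that[of F]) (auto simp: nsets_def intro: finite_subset)
qed

definition hilton_milner :: "'a set \<Rightarrow> nat \<Rightarrow> 'a \<Rightarrow> 'a set \<Rightarrow> 'a set set" where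
  "hilton_milner X k x B = insert B {F \<in> nsets X k. x \<in> F \<and> F \<inter> B \<noteq> {}}"

text \<open>No point \<open>t\<close> is common to all members: if \<open>t\<close> is outside
  \<open>B\<close>, then \<open>B\<close> avoids it; otherwise a \<open>k\<close>-set through
  \<open>x\<close> and another point of \<open>B\<close> does.\<close>

lemma hilton_milner_nontrivial_intersecting:
  assumes "finite X" "k < card X" "2 \<le> k" "x \<in> X" "B \<in> nsets X k" "x \<notin> B"
  shows "nontrivial_intersecting (hilton_milner X k x B)"
proof -
  from assms have B: "B \<subseteq> X" "finite B" "card B = k" "B \<noteq> {}"
    by (auto simp: nsets_def)
  have "intersecting (hilton_milner X k x B)"
    using B unfolding intersecting_def hilton_milner_def by blast
  moreover have "covering_number (hilton_milner X k x B) \<ge> 2"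
  proof (rule covering_number_ge_2I[OF assms(1)])
    show "A \<subseteq> X \<and> A \<noteq> {}" if "A \<in> hilton_milner X k x B" for A
      using that B by (auto simp: hilton_milner_def nsets_def)
  next
    fix t
    show "\<exists>A\<in>hilton_milner X k x B. t \<notin> A"
    proof (cases "t \<in> B")
      case False
      then show ?thesis by (auto simp: hilton_milner_def)
    next
      case True
      have "\<not> B \<subseteq> {t}"
        using B assms(3) card_mono[of "{t}" B] by auto
      then obtain b where b: "b \<in> B" "b \<noteq> t" by blast
      with assms(6) True B assms(4) have "{x, b} \<subseteq> X" "t \<notin> {x, b}" "card {x, b} \<le> k"
        using assms(3) by (auto simp: card_insert_if)
      then obtain F where "F \<in> nsets X k" "{x, b} \<subseteq> F" "t \<notin> F"
        using nsets_extend_avoiding assms(1,2) by metis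
      with b show ?thesis by (auto simp: hilton_milner_def)
    qed
  qed
  ultimately show ?thesis by (simp add: nontrivial_intersecting_def)
qed

definition two_of_three :: "'a set \<Rightarrow> nat \<Rightarrow> 'a set \<Rightarrow> 'a set set" where
  "two_of_three X k T = {F \<in> nsets X k. 2 \<le> card (F \<inter> T)}"

text \<open>Two pairs inside a 3-set must meet. After deleting any \<open>t\<close>, a pair of
  \<open>T\<close> survives and extends to a \<open>k\<close>-set avoiding \<open>t\<close>.\<close>

lemma two_of_three_nontrivial_intersecting:
  assumes "finite X" "k < card X" "2 \<le> k" "T \<subseteq> X" "card T = 3"
  shows "nontrivial_intersecting (two_of_three X k T)"
proof -
  have finT: "finite T" using assms by (auto intro: finite_subset)
  have "A \<inter> B \<noteq> {}" if "2 \<le> card (A \<inter> T)" "2 \<le> card (B \<inter> T)" for A B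
  proof
    assume "A \<inter> B = {}"
    then have "card ((A \<inter> T) \<union> (B \<inter> T)) = card (A \<inter> T) + card (B \<inter> T)"
      using finT by (intro card_Un_disjoint) auto
    moreover have "card ((A \<inter> T) \<union> (B \<inter> T)) \<le> card T"
      using finT by (intro card_mono) auto
    ultimately show False using that assms(5) by linarith
  qed
  then have "intersecting (two_of_three X k T)"
    by (simp add: intersecting_def two_of_three_def)
  moreover have "covering_number (two_of_three X k T) \<ge> 2"
  proof (rule covering_number_ge_2I[OF assms(1)])
    show "A \<subseteq> X \<and> A \<noteq> {}" if "A \<in> two_of_three X k T" for A
      using that by (auto simp: two_of_three_def nsets_def)
  next
    fix t
    have "2 \<le> card (T - {t})"
      using finT assms(5) by (auto simp: card_Diff_singleton_if)
    then obtain P where P: "P \<subseteq> T - {t}" "card P = 2" "finite P"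
      by (rule obtain_subset_with_card_n)
    with assms have "P \<subseteq> X" "card P \<le> k" "t \<notin> P" by auto
    then obtain F where F: "F \<in> nsets X k" "P \<subseteq> F" "t \<notin> F"
      using nsets_extend_avoiding assms(1,2) by metis
    then have "card P \<le> card (F \<inter> T)"
      using finT P by (intro card_mono) auto
    with P F show "\<exists>A\<in>two_of_three X k T. t \<notin> A"
      by (auto simp: two_of_three_def)
  qed
  ultimately show ?thesis by (simp add: nontrivial_intersecting_def)
qed

section \<open>Generating function of partial transversals\<close>

text \<open>The choices in different blocks are independent: a block contributes either nothing,
  with weight 1, or one of its points, each with weight \<open>x\<close>.\<close>

lemma sum_power_card_partial_transversals:
  fixes x :: real
  assumes "finite J" "\<And>j. j \<in> J \<Longrightarrow> finite (T j)" "disjoint_family_on T J"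
  shows "(\<Sum>F | F \<subseteq> (\<Union>j\<in>J. T j) \<and> (\<forall>j\<in>J. card (F \<inter> T j) \<le> 1). x ^ card F)
           = (\<Prod>j\<in>J. 1 + real (card (T j)) * x)"
  using assms
proof (induction J)
  case empty
  have "{F. F \<subseteq> ({} :: 'b set)} = {{}}" by auto
  then show ?case by simp
next
  case (insert j J)
  let ?S = "\<lambda>J. {F. F \<subseteq> (\<Union>j\<in>J. T j) \<and> (\<forall>j\<in>J. card (F \<inter> T j) \<le> 1)}"
  let ?E = "{E. E \<subseteq> T j \<and> card E \<le> 1}"
  have fin: "finite (T j)" "finite (\<Union>j\<in>J. T j)" and disjU: "T j \<inter> (\<Union>j\<in>J. T j) = {}"
    using insert.prems insert.hyps by (auto simp: disjoint_family_on_def)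
  have disj: "T i \<inter> T j = {}" if "i \<in> J" for i
    using that disjU by auto
  have E: "?E = insert {} ((\<lambda>y. {y}) ` T j)"
  proof -
    have "card E \<le> 1 \<longleftrightarrow> E = {} \<or> (\<exists>y. E = {y})" if "E \<subseteq> T j" for E
      using finite_subset[OF that fin(1)]
      by (metis One_nat_def card_1_singleton_iff card_eq_0_iff le_Suc_eq le_zero_eq)
    then show ?thesis by auto
  qed
  have sumE: "(\<Sum>E\<in>?E. x ^ card E) = 1 + real (card (T j)) * x"
    unfolding E using fin(1) by (subst sum.insert) (auto simp: sum.reindex)
  have "(\<Sum>F\<in>?S (insert j J). x ^ card F) = (\<Sum>(F, E)\<in>?S J \<times> ?E. x ^ card F * x ^ card E)"
  \<comment> \<open>A set is cut into its part outside the new block \<open>T j\<close> and its part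
    inside; disjointness makes union the inverse.\<close>
  proof (rule sum.reindex_bij_witness[where i = "\<lambda>(F, E). F \<union> E" and j = "\<lambda>F. (F - T j, F \<inter> T j)"])
    fix F assume F: "F \<in> ?S (insert j J)"
    have "(F - T j) \<inter> T i = F \<inter> T i" if "i \<in> J" for i
      using disj[OF that] by auto
    with F show "(F - T j, F \<inter> T j) \<in> ?S J \<times> ?E" by auto
    have "finite F"
      using F fin by (auto intro: finite_subset[of F "T j \<union> (\<Union>j\<in>J. T j)"])
    then have "card F = card (F - T j) + card (F \<inter> T j)"
      by (subst card_Un_disjoint[symmetric]) (auto intro: arg_cong[of _ _ card])
    then show "(case (F - T j, F \<inter> T j) of (F, E) \<Rightarrow> x ^ card F * x ^ card E) = x ^ card F"
      by (simp add: power_add)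
  next
    fix p assume "p \<in> ?S J \<times> ?E"
    then obtain F E where p: "p = (F, E)" "F \<in> ?S J" "E \<in> ?E" by auto
    have 1: "F \<inter> T j = {}" using p(2) disjU by auto
    have 2: "(F \<union> E) \<inter> T i = F \<inter> T i" if "i \<in> J" for i
      using p(3) disj[OF that] by auto
    have 3: "(F \<union> E) \<inter> T j = E" "F \<union> E - T j = F" using 1 p(3) by auto
    show "(case p of (F, E) \<Rightarrow> F \<union> E) \<in> ?S (insert j J)"
      using p 2 3 by auto
    show "((case p of (F, E) \<Rightarrow> F \<union> E) - T j, (case p of (F, E) \<Rightarrow> F \<union> E) \<inter> T j) = p"
      using p 3 by simp
  qed auto
  also have "\<dots> = (\<Sum>F\<in>?S J. x ^ card F) * (\<Sum>E\<in>?E. x ^ card E)"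
    by (simp add: sum_product sum.cartesian_product)
  also have "(\<Sum>F\<in>?S J. x ^ card F) = (\<Prod>j\<in>J. 1 + real (card (T j)) * x)"
    using insert.prems by (intro insert.IH) (auto simp: disjoint_family_on_def)
  finally show ?case
    using insert.hyps sumE by (simp add: mult.commute)
qed

section \<open>Binomial estimates\<close>

lemma binomial_Suc_mult: "(n choose Suc i) * Suc i = (n choose i) * (n - i)"
  by (metis binomial_absorb_comp binomial_absorption mult.commute)

text \<open>The summand with index \<open>a * p\<close> is the largest one in the binomial expansion of the left-hand side.\<close>

lemma power_le_mode_binomial:
  fixes a b p :: nat
  assumes "a > 0" "b > 0"
  shows "(a + b) ^ ((a + b) * p)
      \<le> ((a + b) * p + 1) * (((a + b) * p choose (a * p)) * a ^ (a * p) * b ^ (b * p))"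
proof -
  define N where "N = (a + b) * p"
  define t where "t i = (N choose i) * a ^ i * b ^ (N - i)" for i
  \<comment> \<open>The ratio of consecutive summands, cleared of denominators; comparing
    \<open>b * Suc i\<close> with \<open>a * (N - i)\<close> decides whether \<open>t\<close> rises
    or falls.\<close>
  have rec: "t (Suc i) * (b * Suc i) = t i * (a * (N - i))" if "i < N" for i
  proof -
    have e: "N - i = Suc (N - Suc i)" using that by simp
    have "(N choose Suc i) * Suc i = (N choose i) * (N - i)"
      by (rule binomial_Suc_mult)
    then have "(N choose Suc i) * Suc i * (a * a ^ i * b * b ^ (N - Suc i))
        = (N choose i) * (N - i) * (a * a ^ i * b * b ^ (N - Suc i))" by simp
    then show ?thesis unfolding t_def using e by (simp add: algebra_simps)
  qed
  have up: "t i \<le> t (Suc i)" if "i < a * p" for i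
  proof -
    have "i < N" using that by (simp add: N_def algebra_simps)
    have "Suc i \<le> a * p" "b * p \<le> N - i" using that by (auto simp: N_def algebra_simps)
    then have "b * Suc i \<le> a * (N - i)"
      by (metis mult.left_commute mult_le_mono2 order_trans)
    then have "t i * (b * Suc i) \<le> t (Suc i) * (b * Suc i)"
      using rec[OF \<open>i < N\<close>] by simp
    then show ?thesis using assms by simp
  qed
  have down: "t (Suc i) \<le> t i" if "a * p \<le> i" for i
  proof (cases "i < N")
    case True
    have "N - i \<le> b * p" "a * p \<le> Suc i" using that by (auto simp: N_def algebra_simps)
    then have "a * (N - i) \<le> b * Suc i"
      by (metis mult.left_commute mult_le_mono2 order_trans)
    then have "t (Suc i) * (b * Suc i) \<le> t i * (b * Suc i)"
      using rec[OF True] by simp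
    then show ?thesis using assms by simp
  qed (simp add: t_def binomial_eq_0)
  have le: "t i \<le> t (a * p)" for i
  proof (cases "i \<le> a * p")
    case True
    then show ?thesis by (induction rule: inc_induct) (use up order_trans in blast)+
  next
    case False
    then have "a * p \<le> i" by simp
    then show ?thesis by (induction rule: dec_induct) (use down order_trans in blast)+
  qed
  have "(a + b) ^ N = (\<Sum>i\<le>N. t i)"
    unfolding t_def by (subst binomial) simp
  also have "\<dots> \<le> (\<Sum>i\<le>N. t (a * p))" by (intro sum_mono le)
  also have "\<dots> = (N + 1) * t (a * p)" by simp
  also have "N - a * p = b * p" by (simp add: N_def algebra_simps)
  then have "t (a * p) = (N choose (a * p)) * a ^ (a * p) * b ^ (b * p)"
    by (simp add: t_def)
  finally show ?thesis by (simp add: N_def)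
qed

text \<open>The left-hand side is a single term of the Vandermonde sum.\<close>

lemma binomial_mult_le_binomial_add:
  "(a choose c) * (b choose d) \<le> (a + b) choose (c + d)"
proof -
  have "(a choose c) * (b choose (c + d - c)) \<le> (\<Sum>i\<le>c + d. (a choose i) * (b choose (c + d - i)))"
    by (rule member_le_sum) auto
  then show ?thesis by (simp add: vandermonde)
qed

text \<open>By Pascal's rule, raising the upper index by one at most doubles the binomial as long as
  \<open>k\<close> is not beyond the middle. This asks for an upper index of at least
  \<open>2 * k - 1\<close>, hence for \<open>m \<ge> 1\<close>.\<close>

lemma binomial_double_le:
  assumes "m \<ge> 1" "m \<le> q" "k \<ge> 1"
  shows "(2 * k - 2 + q) choose k \<le> 2 ^ (q - m) * ((2 * k - 2 + m) choose k)"
  using assms(2)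
proof (induction rule: dec_induct)
  case (step q)
  let ?N = "2 * k - 2 + q"
  have "?N choose (k - 1) \<le> ?N choose k"
  proof -
    have "(?N choose (k - 1)) * k \<le> (?N choose (k - 1)) * (?N - (k - 1))"
      using step.hyps assms by (intro mult_le_mono2) linarith
    also have "\<dots> = (?N choose k) * k"
      using binomial_Suc_mult[of ?N "k - 1"] assms(3) by simp
    finally show ?thesis using assms(3) by simp
  qed
  moreover have "Suc ?N choose k = (?N choose (k - 1)) + (?N choose k)"
    using assms(3) by (cases k) auto
  ultimately show ?case
    using step by (simp add: Suc_diff_le)
qed simp

text \<open>The exponents are the worst case for \<open>k = 4 * p + 4 + r\<close> with
  \<open>r \<le> 3\<close>: then \<open>k div 4 = p + 1\<close> and
  \<open>k \<le> 4 * p + 7\<close>. The mode bound costs only a factor \<open>9 * p + 1\<close>,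
  which exponential growth absorbs.\<close>

lemma eventually_power_less_binomial:
  "\<forall>\<^sub>F p in sequentially.
     (11/4) ^ (p + 1) * (25/4) ^ (4 * p + 7) * (4/7) ^ (4 * p + 7) < real ((9 * p) choose (4 * p))"
proof -
  \<comment> \<open>Since \<open>25/4 * 4/7 = 25/7\<close>, the left-hand side equals
    \<open>C * a ^ p\<close>, while \<open>b\<close> is the growth rate of the binomial per step of
    \<open>p\<close>.\<close>
  define C where "C = (11/4) * (25/7 :: real) ^ 7"
  define a where "a = 11/4 * (25/7 :: real)^4"
  define b where "b = (9^9 / (4^4 * 5^5) :: real)"
  have "b > 0" "norm (a / b) < 1" by (simp_all add: a_def b_def power_divide)
  then have "(\<lambda>p. 9 * C * (real p * (a / b) ^ p) + C * (a / b) ^ p) \<longlonglongrightarrow> 9 * C * 0 + C * 0"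
    by (intro tendsto_intros powser_times_n_limit_0 LIMSEQ_power_zero)
  then have "\<forall>\<^sub>F p in sequentially. 9 * C * (real p * (a / b) ^ p) + C * (a / b) ^ p < 1"
    by (rule order_tendstoD) simp
  then have "\<forall>\<^sub>F p in sequentially. C * a ^ p * (9 * real p + 1) < b ^ p"
    by eventually_elim (use \<open>b > 0\<close> in \<open>simp add: field_simps\<close>)
  then show ?thesis
  proof eventually_elim
    case (elim p)
    have "9 ^ (9 * p) \<le> (9 * p + 1) * (((9 * p) choose (4 * p)) * 4 ^ (4 * p) * 5 ^ (5 * p))"
      using power_le_mode_binomial[of 4 5 p] by (simp only: numeral_plus_numeral add_num_simps)
    then have "real (9 ^ (9 * p)) \<le> real ((9 * p + 1) * (((9 * p) choose (4 * p)) * 4 ^ (4 * p) * 5 ^ (5 * p)))"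
      by (simp only: of_nat_le_iff)
    then have "9 ^ (9 * p) \<le> ((9 * real p + 1) * real ((9 * p) choose (4 * p))) * (4 ^ (4 * p) * 5 ^ (5 * p))"
      by (simp only: of_nat_mult of_nat_power of_nat_add of_nat_numeral of_nat_1 mult.assoc)
    moreover have "b ^ p = 9 ^ (9 * p) / (4 ^ (4 * p) * 5 ^ (5 * p))"
      by (simp only: b_def power_divide power_mult power_mult_distrib)
    ultimately have "b ^ p \<le> (9 * real p + 1) * real ((9 * p) choose (4 * p))"
      by (simp only: pos_divide_le_eq zero_less_mult_iff zero_less_power zero_less_numeral simp_thms)
    with elim have "C * a ^ p * (9 * real p + 1) < (9 * real p + 1) * real ((9 * p) choose (4 * p))"
      by (rule order_less_le_trans)
    then have "C * a ^ p < real ((9 * p) choose (4 * p))"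
      by (subst (asm) mult.commute, subst (asm) mult_less_cancel_left_pos) simp_all
    moreover have "(11/4) ^ (p + 1) * (25/4) ^ (4 * p + 7) * (4/7) ^ (4 * p + 7) = C * a ^ p"
    proof -
      have "(25/4) ^ (4 * p + 7) * (4/7) ^ (4 * p + 7) = (25/7 :: real) ^ (4 * p + 7)"
        by (subst power_mult_distrib[symmetric]) simp
      moreover have "(11/4) ^ (p + 1) * (25/7) ^ (4 * p + 7) = C * a ^ p"
        by (simp only: C_def a_def power_add power_mult power_mult_distrib) simp
      ultimately show ?thesis by (simp only: mult.assoc)
    qed
    ultimately show ?case by simp
  qed
qed

text \<open>The bases are \<open>1 + x\<close> and \<open>1 + 3 * x\<close> at
  \<open>x = 7/4\<close>. First \<open>m\<close> is raised to \<open>k div 4\<close>, then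
  \<open>k\<close> is rounded so that both sides depend on one parameter \<open>p\<close>.\<close>

lemma power_less_binomial:
  "\<exists>k0. \<forall>k\<ge>k0. \<forall>m. 0 < m \<and> 4 * m \<le> k \<longrightarrow>
     (11/4) ^ m * (25/4) ^ (k - 1) < (7/4) ^ k * real ((2 * k - 2 + m) choose k)"
proof -
  obtain p0 where p0: "\<And>p. p \<ge> p0 \<Longrightarrow>
     (11/4) ^ (p + 1) * (25/4) ^ (4 * p + 7) * (4/7) ^ (4 * p + 7) < real ((9 * p) choose (4 * p))"
    using eventually_power_less_binomial by (auto simp: eventually_sequentially)
  have "(11/4) ^ m * (25/4) ^ (k - 1) < (7/4) ^ k * real ((2 * k - 2 + m) choose k)"
    if k: "k \<ge> 4 * p0 + 4" and m: "0 < m" "4 * m \<le> k" for k m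
  proof -
    define q where "q = k div 4"
    define p where "p = q - 1"
    define r where "r = k - 4 * q"
    have q: "q = p + 1" "p \<ge> p0" "m \<le> q" "k = 4 * p + 4 + r" "r \<le> 3"
      using k m by (auto simp: q_def p_def r_def)
    \<comment> \<open>The factor \<open>2 ^ (q - m)\<close> is the cost of raising \<open>m\<close>
      to \<open>q\<close> in the binomial; it is dominated because \<open>2 < 11/4\<close>.\<close>
    have "(11/4) ^ m * 2 ^ (q - m) \<le> (11/4) ^ m * (11/4 :: real) ^ (q - m)"
      by (intro mult_left_mono power_mono) auto
    also have "\<dots> = (11/4) ^ (p + 1)"
      using q by (simp flip: power_add)
    finally have 1: "(11/4) ^ m * 2 ^ (q - m) \<le> (11/4 :: real) ^ (p + 1)" .
    have "(25/4) ^ (k - 1) * (4/7) ^ k \<le> (25/4) ^ k * (4/7 :: real) ^ k"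
      by (intro mult_right_mono power_increasing) auto
    also have "\<dots> = (25/7) ^ k"
      by (subst power_mult_distrib[symmetric]) simp
    also have "\<dots> \<le> (25/7) ^ (4 * p + 7)"
      using q by (intro power_increasing) auto
    also have "\<dots> = (25/4) ^ (4 * p + 7) * (4/7) ^ (4 * p + 7)"
      by (subst power_mult_distrib[symmetric]) simp
    finally have 2: "(25/4) ^ (k - 1) * (4/7) ^ k \<le> (25/4) ^ (4 * p + 7) * (4/7 :: real) ^ (4 * p + 7)" .
    have "((11/4) ^ m * 2 ^ (q - m)) * ((25/4) ^ (k - 1) * (4/7) ^ k)
        \<le> (11/4) ^ (p + 1) * ((25/4) ^ (4 * p + 7) * (4/7 :: real) ^ (4 * p + 7))"
      by (rule mult_mono[OF 1 2]) simp_all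
    also have "\<dots> < real ((9 * p) choose (4 * p))"
      using p0[OF q(2)] by (simp only: mult.assoc)
    also have "\<dots> \<le> real ((2 * k - 2 + q) choose k)"
    proof -
      \<comment> \<open>The second factor holds what rounding left over:
        \<open>2 * k - 2 + q = 9 * p + (7 + 2 * r)\<close> and \<open>k = 4 * p + (4 + r)\<close>.
        It is at least 1.\<close>
      have "(9 * p) choose (4 * p) \<le> ((9 * p) choose (4 * p)) * ((7 + 2 * r) choose (4 + r))"
        using zero_less_binomial[of "4 + r" "7 + 2 * r"] by (simp add: Suc_le_eq)
      also have "\<dots> \<le> (9 * p + (7 + 2 * r)) choose (4 * p + (4 + r))"
        by (rule binomial_mult_le_binomial_add)
      also have "9 * p + (7 + 2 * r) = 2 * k - 2 + q" using q by simp
      finally show ?thesis using q by (simp add: add.assoc)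
    qed
    also have "\<dots> \<le> 2 ^ (q - m) * real ((2 * k - 2 + m) choose k)"
    proof -
      have "(2 * k - 2 + q) choose k \<le> 2 ^ (q - m) * ((2 * k - 2 + m) choose k)"
        using q m k by (intro binomial_double_le) auto
      from of_nat_mono[OF this, where 'a = real] show ?thesis by simp
    qed
    finally have "2 ^ (q - m) * ((11/4) ^ m * ((25/4) ^ (k - 1) * (4/7) ^ k))
        < 2 ^ (q - m) * real ((2 * k - 2 + m) choose k)" by (simp add: mult_ac)
    then have "(11/4) ^ m * ((25/4) ^ (k - 1) * (4/7) ^ k) < real ((2 * k - 2 + m) choose k)"
      by simp
    then have "(7/4) ^ k * ((11/4) ^ m * ((25/4) ^ (k - 1) * (4/7) ^ k))
        < (7/4) ^ k * real ((2 * k - 2 + m) choose k)" by simp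
    also have "(7/4) ^ k * ((11/4) ^ m * ((25/4) ^ (k - 1) * (4/7) ^ k))
        = ((7/4) ^ k * (4/7) ^ k) * ((11/4 :: real) ^ m * (25/4) ^ (k - 1))"
      by (simp only: mult_ac)
    also have "(7/4) ^ k * (4/7) ^ k = (1::real)"
      by (subst power_mult_distrib[symmetric]) simp
    finally show ?thesis by simp
  qed
  then show ?thesis by blast
qed

section \<open>The families attached to a partition into blocks\<close>

text \<open>The condition \<open>v + card M = k + 1\<close> gives the exceptional sets
  \<open>B j y\<close> size \<open>k\<close>, and \<open>k = card J + 1\<close> feeds the pigeonhole
  argument. Since \<open>\<G>\<close> is a set, its size is only bounded above: families could
  coincide.\<close>

lemma nontrivial_families_of_partition:
  fixes V T :: "'i \<Rightarrow> 'a set" and M :: "'a set" and x :: real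
  assumes J: "finite J" "J \<noteq> {}"
    and V: "disjoint_family_on V J" "\<And>j. j \<in> J \<Longrightarrow> finite (V j) \<and> card (V j) = v"
    and T: "\<And>j. j \<in> J \<Longrightarrow> T j \<subseteq> V j \<and> card (T j) = 3"
    and M: "finite M" "\<And>j. j \<in> J \<Longrightarrow> M \<inter> V j = {}"
    and X: "X = M \<union> (\<Union>j\<in>J. V j)"
    and k: "k = card J + 1" "v + card M = k + 1"
    and x: "x \<ge> 0"
  obtains \<G> where "finite \<G>" "\<G> \<noteq> {}" "card \<G> \<le> card J * (v - 2)"
    "\<And>G. G \<in> \<G> \<Longrightarrow> G \<subseteq> nsets X k \<and> nontrivial_intersecting G"
    "real (card (nsets X k - \<Union>\<G>)) * x ^ k \<le> (1 + x) ^ card M * (1 + 3 * x) ^ card J"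
proof -
  define B where "B j y = V j - {y} \<union> M" for j y
  define \<G> where "\<G> = (\<Union>j\<in>J. (\<lambda>y. hilton_milner X k y (B j y)) ` (V j - T j))
      \<union> (\<lambda>j. two_of_three X k (T j)) ` J"
  have finX: "finite X" using X J M V by auto
  have "card J > 0" using J by (simp add: card_gt_0_iff)
  have v: "3 \<le> v"
  proof -
    obtain j where "j \<in> J" using J by blast
    then show ?thesis using T[of j] V(2)[of j] card_mono[of "V j" "T j"] by auto
  qed
  have "card X = card M + card (\<Union>j\<in>J. V j)"
    unfolding X using M V J by (intro card_Un_disjoint) auto
  also have "card (\<Union>j\<in>J. V j) = card J * v"
    using V J by (subst card_UN_disjoint) (auto simp: disjoint_family_on_def)
  finally have "card X = card M + card J * v" .
  \<comment> \<open>Three points per block already exceed \<open>card J + 1 = k\<close>.\<close>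
  moreover have "card J * 3 \<le> card J * v" using v by simp
  ultimately have cardX: "k < card X"
    using k v \<open>card J > 0\<close> by (cases "card M = 0") linarith+
  have B: "B j y \<in> nsets X k" "y \<notin> B j y" if "j \<in> J" "y \<in> V j" for j y
  proof -
    have "card (B j y) = card (V j - {y}) + card M"
      unfolding B_def using that V M by (intro card_Un_disjoint) auto
    also have "\<dots> = k" using that V(2)[of j] k v by (auto simp: card_Diff_singleton_if)
    finally show "B j y \<in> nsets X k"
      using that X V M by (auto simp: nsets_def B_def)
    show "y \<notin> B j y" using that M(2)[of j] by (auto simp: B_def)
  qed
  show thesis
  proof
    show "finite \<G>" using J V by (auto simp: \<G>_def)
    show "\<G> \<noteq> {}" using J by (auto simp: \<G>_def)
    have "card \<G> \<le> card (\<Union>j\<in>J. (\<lambda>y. hilton_milner X k y (B j y)) ` (V j - T j))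
        + card ((\<lambda>j. two_of_three X k (T j)) ` J)"
      unfolding \<G>_def by (rule card_Un_le)
    also have "\<dots> \<le> (\<Sum>j\<in>J. v - 3) + card J"
    proof (intro add_mono card_image_le J)
      have "card (\<Union>j\<in>J. (\<lambda>y. hilton_milner X k y (B j y)) ` (V j - T j))
          \<le> (\<Sum>j\<in>J. card ((\<lambda>y. hilton_milner X k y (B j y)) ` (V j - T j)))"
        by (rule card_UN_le[OF J(1)])
      also have "\<dots> \<le> (\<Sum>j\<in>J. v - 3)"
      proof (rule sum_mono)
        fix j assume j: "j \<in> J"
        have "card ((\<lambda>y. hilton_milner X k y (B j y)) ` (V j - T j)) \<le> card (V j - T j)"
          using V j by (intro card_image_le) auto
        also have "\<dots> = v - 3"
          using V(2)[OF j] T[OF j] by (subst card_Diff_subset) (auto intro: finite_subset)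
        finally show "card ((\<lambda>y. hilton_milner X k y (B j y)) ` (V j - T j)) \<le> v - 3" .
      qed
      finally show "card (\<Union>j\<in>J. (\<lambda>y. hilton_milner X k y (B j y)) ` (V j - T j))
          \<le> (\<Sum>j\<in>J. v - 3)" .
    qed
    also have "\<dots> = card J * (v - 3 + 1)" by (simp add: distrib_left)
    also have "v - 3 + 1 = v - 2" using v by simp
    finally show "card \<G> \<le> card J * (v - 2)" .
  next
    fix G assume "G \<in> \<G>"
    then consider j y where "j \<in> J" "y \<in> V j" "G = hilton_milner X k y (B j y)"
      | j where "j \<in> J" "G = two_of_three X k (T j)"
      unfolding \<G>_def by blast
    then show "G \<subseteq> nsets X k \<and> nontrivial_intersecting G"
    proof cases
      case 1
      moreover have "y \<in> X" using 1 X by auto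
      ultimately show ?thesis
        using hilton_milner_nontrivial_intersecting[of X k y "B j y"] finX cardX B[of j y]
          k(1) \<open>card J > 0\<close> by (auto simp: hilton_milner_def)
    next
      case 2
      moreover have "T j \<subseteq> X" using 2 T[of j] X by auto
      ultimately show ?thesis
        using two_of_three_nontrivial_intersecting[of X k "T j"] finX cardX T[of j]
          k(1) \<open>card J > 0\<close> by (auto simp: two_of_three_def)
    qed
  next
    \<comment> \<open>Each point of \<open>M\<close> becomes a block of its own, so that one product
      over \<open>J <+> M\<close> yields both kinds of factors.\<close>
    define T' where "T' = case_sum T (\<lambda>y. {y})"
    let ?S = "{F. F \<subseteq> (\<Union>j\<in>J <+> M. T' j) \<and> (\<forall>j\<in>J <+> M. card (F \<inter> T' j) \<le> 1)}"
    have UT': "(\<Union>j\<in>J <+> M. T' j) = (\<Union>j\<in>J. T j) \<union> M"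
      by (simp add: Plus_def T'_def UN_Un)
    have finT: "finite (T j)" if "j \<in> J" for j
      using that T V by (meson finite_subset)
    have sub: "F \<in> ?S" if F: "F \<in> nsets X k - \<Union>\<G>" for F
    proof -
      have finF: "finite F" "F \<subseteq> X" "card F = k" using F by (auto simp: nsets_def)
      have T1: "card (F \<inter> T j) \<le> 1" if "j \<in> J" for j
        using F that by (force simp: \<G>_def two_of_three_def)
      \<comment> \<open>Containing the centre \<open>y\<close> but lying outside its Hilton-Milner
        family forces \<open>F\<close> to miss \<open>B j y\<close>, that is, \<open>M\<close> and
        the rest of the block.\<close>
      have star: "F \<inter> M = {} \<and> F \<inter> V j = {y}" if "j \<in> J" "y \<in> F" "y \<in> V j - T j" for j y
      proof -
        have "F \<notin> hilton_milner X k y (B j y)"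
          using F that by (auto simp: \<G>_def)
        then have "F \<inter> B j y = {}"
          using F that by (auto simp: hilton_milner_def)
        then show ?thesis using that by (auto simp: B_def)
      qed
      have "F \<subseteq> M \<union> (\<Union>j\<in>J. T j)"
      proof (rule ccontr)
        assume "\<not> F \<subseteq> M \<union> (\<Union>j\<in>J. T j)"
        then obtain y where "y \<in> F" "y \<notin> M \<union> (\<Union>j\<in>J. T j)" by blast
        moreover from this obtain j where "j \<in> J" "y \<in> V j"
          using finF X by auto
        ultimately have "y \<in> F" "j \<in> J" "y \<in> V j - T j" by auto
        then have "F \<inter> M = {}" using star by blast
        \<comment> \<open>A block met only inside \<open>T i\<close> is controlled by the
          two-of-three family, any other block by \<open>star\<close>.\<close>
        have V1: "card (F \<inter> V i) \<le> 1" if i: "i \<in> J" for i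
        proof (cases "F \<inter> V i \<subseteq> T i")
          case True
          then have "F \<inter> V i = F \<inter> T i" using T[OF i] by blast
          then show ?thesis using T1[OF i] by simp
        next
          case False
          then obtain z where "F \<inter> V i = {z}" using star[OF i] by blast
          then show ?thesis by simp
        qed
        have "F = (\<Union>i\<in>J. F \<inter> V i)" using \<open>F \<inter> M = {}\<close> finF X by blast
        then have "card F \<le> (\<Sum>i\<in>J. card (F \<inter> V i))"
          using card_UN_le[OF J(1)] by metis
        also have "\<dots> \<le> (\<Sum>i\<in>J. 1)" by (intro sum_mono V1)
        finally show False using finF k by simp
      qed
      moreover have "card (F \<inter> {y}) \<le> 1" for y
        using card_mono[of "{y}" "F \<inter> {y}"] by simp
      ultimately show ?thesis
        unfolding UT' using T1 by (auto simp: T'_def)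
    qed
    have finS: "finite ?S"
      using J M finT by (intro finite_subset[of ?S "Pow (\<Union>j\<in>J <+> M. T' j)"]) (auto simp: UT')
    have "real (card (nsets X k - \<Union>\<G>)) * x ^ k = (\<Sum>F\<in>nsets X k - \<Union>\<G>. x ^ card F)"
      by (simp add: nsets_def)
    \<comment> \<open>The size restriction is dropped here; the added terms are nonnegative because
      \<open>x \<ge> 0\<close>.\<close>
    also have "\<dots> \<le> (\<Sum>F\<in>?S. x ^ card F)"
      using finS sub x by (intro sum_mono2) auto
    also have "\<dots> = (\<Prod>j\<in>J <+> M. 1 + real (card (T' j)) * x)"
    proof (rule sum_power_card_partial_transversals)
      show "disjoint_family_on T' (J <+> M)"
      proof -
        have "T i \<inter> T j = {}" if "i \<in> J" "j \<in> J" "i \<noteq> j" for i j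
          using that V(1) T[of i] T[of j] by (auto simp: disjoint_family_on_def) blast
        moreover have "y \<notin> T j" if "j \<in> J" "y \<in> M" for j y
          using that M(2)[of j] T[of j] by blast
        ultimately show ?thesis by (auto simp: disjoint_family_on_def T'_def) blast
      qed
    qed (use J M finT in \<open>auto simp: T'_def\<close>)
    also have "\<dots> = (1 + x) ^ card M * (1 + 3 * x) ^ card J"
      using J M T by (simp add: prod.Plus T'_def o_def mult.commute)
    finally show "real (card (nsets X k - \<Union>\<G>)) * x ^ k \<le> (1 + x) ^ card M * (1 + 3 * x) ^ card J" .
  qed
qed

section \<open>Blocks of consecutive integers and the final count\<close>

text \<open>Repetitions are allowed, so fewer than \<open>s\<close> families suffice; nonemptiness
  supplies a value for the surplus indices.\<close>

lemma ex_enumeration_atLeastAtMost: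
  assumes "finite \<G>" "\<G> \<noteq> {}" "card \<G> \<le> s"
  obtains f :: "nat \<Rightarrow> 'a" where "f ` {1..s} = \<G>"
proof -
  have "\<exists>g. inj_on g \<G> \<and> g ` \<G> \<subseteq> {1..s}"
    using assms card_le_inj[of \<G> "{1..s}"] by auto
  then show thesis
    using that inj_on_iff_surj[OF assms(2)] by metis
qed

theorem theorem3:
  "\<exists>k0::nat. \<forall>k\<ge>k0. \<forall>m::nat. 0 < m \<and> real m \<le> real k / 4 \<longrightarrow>
     (let n = (k - 1) * (k + 1 - m) + m;
          s = n - 2 * k + 2 - m
      in \<exists>\<F> :: nat \<Rightarrow> nat set set.
           (\<forall>i\<in>{1..s}. \<F> i \<subseteq> nsets {1..n} k \<and> nontrivial_intersecting (\<F> i)) \<and>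
           int (card (\<Union>i\<in>{1..s}. \<F> i)) > int (n choose k) - int ((n - s) choose k))"
proof -
  obtain k0 where k0: "\<And>k m. k0 \<le> k \<Longrightarrow> 0 < m \<Longrightarrow> 4 * m \<le> k \<Longrightarrow>
     (11/4) ^ m * (25/4) ^ (k - 1) < (7/4) ^ k * real ((2 * k - 2 + m) choose k)"
    using power_less_binomial by blast
  show ?thesis
  proof (intro exI[of _ k0] allI impI, unfold Let_def)
    fix k m :: nat
    assume "k0 \<le> k" and m: "0 < m \<and> real m \<le> real k / 4"
    define v where "v = k + 1 - m"
    define n where "n = (k - 1) * v + m"
    define s where "s = n - 2 * k + 2 - m"
    from m have m: "0 < m" "4 * m \<le> k" by auto
    then have v: "v \<ge> 3" "v + m = k + 1" and "k \<ge> 4" by (auto simp: v_def)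
    have n: "n = (k - 1) * (v - 2) + 2 * (k - 1) + m"
      using v(1) by (simp add: n_def diff_mult_distrib2 flip: distrib_left)
    \<comment> \<open>This makes \<open>n\<close> large enough that no subtraction in
      \<open>s\<close> is truncated.\<close>
    moreover have "(k - 1) * 1 \<le> (k - 1) * (v - 2)"
      using v(1) by (intro mult_le_mono2) simp
    ultimately have s: "s = (k - 1) * (v - 2)" "n - s = 2 * k - 2 + m"
      unfolding s_def using \<open>k \<ge> 4\<close> m by linarith+
    \<comment> \<open>Intervals open on the left tile \<open>{0<..(k - 1) * v}\<close> without
      overlap; \<open>M\<close> takes the remaining \<open>m\<close> points.\<close>
    define V where "V j = {j * v<..j * v + v}" for j
    define T where "T j = {j * v<..j * v + 3}" for j
    define M where "M = {(k - 1) * v<..n}"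
    have le: "i * v + v \<le> j * v" if "i < j" for i j
      using mult_le_mono1[of "Suc i" j v] that by simp
    have disjV: "disjoint_family_on V {..<k - 1}"
      unfolding disjoint_family_on_def
    proof (intro ballI impI)
      fix i j :: nat assume "i \<noteq> j"
      then show "V i \<inter> V j = {}"
        using le[of i j] le[of j i] by (cases "i < j") (auto simp: V_def)
    qed
    have "{0<..l * v} = (\<Union>j<l. V j)" for l
    proof (induction l)
      case (Suc l)
      have "{0<..Suc l * v} = {0<..l * v} \<union> V l" by (auto simp: V_def)
      with Suc show ?case by (auto simp: lessThan_Suc)
    qed simp
    moreover have "{1..n} = M \<union> {0<..(k - 1) * v}" by (auto simp: M_def n_def)
    ultimately have X: "{1..n} = M \<union> (\<Union>j<k - 1. V j)" by metis
    have VT: "finite (V j) \<and> card (V j) = v" "T j \<subseteq> V j \<and> card (T j) = 3" for j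
      using v(1) by (auto simp: V_def T_def)
    have MV: "M \<inter> V j = {}" if "j \<in> {..<k - 1}" for j
      using le[of j "k - 1"] that by (auto simp: M_def V_def)
    have k: "finite {..<k - 1}" "{..<k - 1} \<noteq> {}" "k = card {..<k - 1} + 1" "finite M" "card M = m"
      using \<open>k \<ge> 4\<close> by (auto simp: M_def n_def lessThan_empty_iff)
    then have "v + card M = k + 1" using v by simp
    from nontrivial_families_of_partition
      [OF k(1,2) disjV VT k(4) MV X k(3) this, where x = "7/4"]
    obtain \<G> where \<G>: "finite \<G>" "\<G> \<noteq> {}" "card \<G> \<le> (k - 1) * (v - 2)"
      "\<And>G. G \<in> \<G> \<Longrightarrow> G \<subseteq> nsets {1..n} k \<and> nontrivial_intersecting G"
      "real (card (nsets {1..n} k - \<Union>\<G>)) * (7/4) ^ k \<le> (1 + 7/4) ^ m * (1 + 3 * (7/4)) ^ (k - 1)"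
      unfolding card_lessThan k(5) by (metis divide_nonneg_nonneg zero_le_numeral)
    have "card \<G> \<le> s" using \<G>(3) s(1) by simp
    then obtain \<F> where \<F>: "\<F> ` {1..s} = \<G>"
      by (rule ex_enumeration_atLeastAtMost[OF \<G>(1,2)])
    note \<G>(5)
    also have "(1 + 7/4) ^ m * (1 + 3 * (7/4)) ^ (k - 1) < real ((n - s) choose k) * (7/4 :: real) ^ k"
      unfolding s(2) using k0[OF \<open>k0 \<le> k\<close> m] by (subst mult.commute[of "real _"]) simp
    finally have "real (card (nsets {1..n} k - \<Union>\<G>)) * (7/4) ^ k < real ((n - s) choose k) * (7/4) ^ k" .
    then have "card (nsets {1..n} k - \<Union>\<G>) < (n - s) choose k" by simp
    moreover have "card (nsets {1..n} k - \<Union>\<G>) = (n choose k) - card (\<Union>\<G>)"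
      using \<G>(4) by (subst card_Diff_subset) (auto intro: finite_subset[OF _ finite_imp_finite_nsets])
    \<comment> \<open>Needed to read the preceding natural-number difference as an integer
      one.\<close>
    moreover have "card (\<Union>\<G>) \<le> n choose k"
      using \<G>(4) card_mono[of "nsets {1..n} k" "\<Union>\<G>"] by (auto simp: finite_imp_finite_nsets)
    ultimately have "int (card (\<Union>i\<in>{1..s}. \<F> i)) > int (n choose k) - int ((n - s) choose k)"
      unfolding \<F> by linarith
    moreover have "\<forall>i\<in>{1..s}. \<F> i \<subseteq> nsets {1..n} k \<and> nontrivial_intersecting (\<F> i)"
      using \<G>(4) \<F> by blast
    ultimately show "\<exists>\<F> :: nat \<Rightarrow> nat set set.
        (\<forall>i\<in>{1..(k - 1) * (k + 1 - m) + m - 2 * k + 2 - m}.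
           \<F> i \<subseteq> nsets {1..(k - 1) * (k + 1 - m) + m} k \<and> nontrivial_intersecting (\<F> i)) \<and>
        int (((k - 1) * (k + 1 - m) + m) choose k)
          - int (((k - 1) * (k + 1 - m) + m - ((k - 1) * (k + 1 - m) + m - 2 * k + 2 - m)) choose k)
        < int (card (\<Union>i\<in>{1..(k - 1) * (k + 1 - m) + m - 2 * k + 2 - m}. \<F> i))"
      unfolding s_def n_def v_def by blast
  qed
qed

end
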